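(* Fix the grid $\mathcal{T}^n$. By adding one point $s_1\in(x_n,1)$ arbitrarily, we obtain a new grid $\mathcal{T}^{n+1}=\mathcal{T}^n\cup\{s_1\}$. Then the intersection $Q_i$ of $u^n$ and $u^{n+1}$ in the interval $(x_{i-1},x_i)$ is independent of the choice of $s_1$ for any $i=2,3,\dots,n$. That is, the coordinates of these intersections do not depend on the choice of $s_1\in(x_n,x_{n+1})$.
   Context: Consider the boundary value problem $-\varepsilon u''-bu'+cu=f$ for $x\in[0,1]$, $u(0)=u(1)=0$, where $b\le 0$, $c\ge 0$ and $0<\varepsilon\ll 1$ are constants, and $b,c$ are not both $0$. Let $H^1=\{v: v,v'\in L^2\}$ and $H_0^1=\{v\in H^1: v(0)=v(1)=0\}$, let $(\cdot,\cdot)$ be the $L^2$ inner product on $[0,1]$, and let $a(u,v)=\varepsilon(u',v')+b(u,v')+c(u,v)$. The weak solution is $u\in H_0^1$ with $a(u,v)=(f,v)$ for all $v\in H_0^1$. It is assumed that $u$ has a boundary layer at $x=1$ (a small interval, of length depending on $\varepsilon$, in which $u''$ varies rapidly) and that $x_n$ is located outside the boundary layer. Here $n\ge 2$ and $\mathcal{T}^n=\{0=x_0<x_1<\dots<x_n<x_{n+1}=1\}$ is an arbitrary grid. For a grid $\mathcal{T}$ of $[0,1]$, the finite element space is the set of continuous functions on $[0,1]$ that are affine between consecutive nodes of $\mathcal{T}$ and vanish at $0$ and $1$ (the span of the nodal hat functions at the interior nodes). The finite element solution on $\mathcal{T}$ is the unique function $u_{\mathcal{T}}$ in this space with $a(u_{\mathcal{T}},v)=(f,v)$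 for all $v$ in this space. $u^n$ and $u^{n+1}$ denote the finite element solutions on $\mathcal{T}^n$ and $\mathcal{T}^{n+1}$. $Q_i$ denotes the intersection (point) of the graphs of $u^n$ and $u^{n+1}$ in the interval $(x_{i-1},x_i)$. *)

theory Defs
  imports "HOL-Analysis.Analysis"
begin

definition L2_space :: "(real \<Rightarrow> real) set" where
  "L2_space = {f. f \<in> borel_measurable (lebesgue_on {0..1}) \<and>
                  integrable (lebesgue_on {0..1}) (\<lambda>x. (f x)\<^sup>2)}"

definition L2_inner :: "(real \<Rightarrow> real) \<Rightarrow> (real \<Rightarrow> real) \<Rightarrow> real" where
  "L2_inner u v = (LINT x|lebesgue_on {0..1}. u x * v x)"

text \<open>The bilinear form is only applied to continuous piecewise affine functions. Their classical
  derivative exists outside the finitely many nodes and represents the weak derivative; the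
  unspecified values of \<^const>\<open>deriv\<close> at the nodes do not influence the integrals.\<close>

definition bilin :: "real \<Rightarrow> real \<Rightarrow> real \<Rightarrow> (real \<Rightarrow> real) \<Rightarrow> (real \<Rightarrow> real) \<Rightarrow> real" where
  "bilin \<epsilon> b c u v =
     \<epsilon> * L2_inner (deriv u) (deriv v) + b * L2_inner u (deriv v) + c * L2_inner u v"

text \<open>A grid is given by its finite set of nodes \<open>T\<close>, which is meant to satisfy
  \<open>{0, 1} \<subseteq> T \<subseteq> {0..1}\<close>. Functions on the unit interval are total
  functions whose values outside \<open>{0..1}\<close> are irrelevant.\<close>

definition fe_space :: "real set \<Rightarrow> (real \<Rightarrow> real) set" where
  "fe_space T = {v. continuous_on {0..1} v \<and> v 0 = 0 \<and> v 1 = 0 \<and>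
     (\<forall>p\<in>T. \<forall>q\<in>T. p < q \<and> T \<inter> {p<..<q} = {} \<longrightarrow>
        (\<exists>k d. \<forall>x\<in>{p..q}. v x = k * x + d))}"

definition fe_solution ::
  "real \<Rightarrow> real \<Rightarrow> real \<Rightarrow> (real \<Rightarrow> real) \<Rightarrow> real set \<Rightarrow> (real \<Rightarrow> real) \<Rightarrow> bool" where
  "fe_solution \<epsilon> b c f T u \<longleftrightarrow>
     u \<in> fe_space T \<and> (\<forall>v\<in>fe_space T. bilin \<epsilon> b c u v = L2_inner f v)"

definition graph_over :: "real set \<Rightarrow> (real \<Rightarrow> real) \<Rightarrow> (real \<times> real) set" where
  "graph_over A u = (\<lambda>x. (x, u x)) ` A"

text \<open>\<open>Q\<close> is the one and only common point of the two graphs over the interval; graphs that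
  coincide on the interval, or do not meet there, have no intersection point.\<close>

definition intersection_point ::
  "(real \<Rightarrow> real) \<Rightarrow> (real \<Rightarrow> real) \<Rightarrow> real set \<Rightarrow> real \<times> real \<Rightarrow> bool" where
  "intersection_point u v A Q \<longleftrightarrow> graph_over A u \<inter> graph_over A v = {Q}"

end

theory Submission
  imports Defs
begin

text \<open>
  Let \<open>w\<^sub>s = u\<^sub>s - u\<close>, where \<open>u\<^sub>s\<close> is the finite element solution on the grid enriched by \<open>s\<close>,
  and let \<open>m = x\<^sub>n\<close>. By Galerkin orthogonality \<open>a(w\<^sub>s, v) = 0\<close> for every \<open>v\<close> in the coarse space.
  The graphs of \<open>u\<close> and \<open>u\<^sub>s\<close> meet exactly where \<open>w\<^sub>s\<close> vanishes, so everything follows once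
  \<open>w\<^sub>s\<close> and \<open>w\<^sub>t\<close> are shown to be proportional on \<open>[0, m]\<close>.

  One could read the orthogonality as a three-term recurrence for the nodal values, but its leading
  coefficient may vanish. Coercivity avoids this. If a function \<open>w\<close> orthogonal to the coarse space
  has no new node in \<open>[0, m]\<close> and \<open>w(m) = 0\<close>, then its truncation \<open>z\<close> (equal to \<open>w\<close> on
  \<open>[0, m]\<close> and to \<open>0\<close> beyond) is itself a coarse test function, whence
  \<open>0 = a(w, z) = a(z, z) = \<epsilon> (z', z') + c (z, z)\<close> and \<open>z = 0\<close>; the convection term drops out
  because \<open>(z, z') = (z(1)\<^sup>2 - z(0)\<^sup>2) / 2\<close>. This is lemma \<open>orthogonal_vanishes_left\<close>.
  Applied to \<open>w\<^sub>s(m) w\<^sub>t - w\<^sub>t(m) w\<^sub>s\<close> it gives \<open>w\<^sub>s(m) w\<^sub>t = w\<^sub>t(m) w\<^sub>s\<close> on \<open>[0, m]\<close>.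
  If \<open>w\<^sub>s(m) = 0\<close>, the same lemma makes \<open>u\<close> and \<open>u\<^sub>s\<close> agree on a whole interval, where they
  then have no single intersection point. If neither value is zero, \<open>w\<^sub>s\<close> and \<open>w\<^sub>t\<close> have the same
  zeros in \<open>[0, m]\<close>.

  There remains \<open>w\<^sub>t(m) = 0\<close>. Then \<open>w\<^sub>t\<close> is a multiple of the hat function at \<open>t\<close>, supported in
  \<open>[m, 1]\<close>. Testing with the coarse function \<open>\<phi>\<close> that is affine on \<open>[0, m]\<close> and on \<open>[m, 1]\<close> with
  \<open>\<phi>(m) = 1\<close> kills the diffusion term and leaves the integral of
  \<open>w\<^sub>t (- b / (1 - m) + c \<phi>)\<close>, whose second factor is positive on \<open>(m, 1)\<close> since \<open>b \<le> 0 \<le> c\<close> are not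
  both zero. Hence \<open>w\<^sub>t = 0\<close> and \<open>u\<^sub>t = u\<close> (lemma \<open>orthogonal_vanishes_right\<close>).
\<close>

section \<open>Grids and piecewise affine functions\<close>

definition grid :: "real set \<Rightarrow> bool" where
  "grid T \<longleftrightarrow> finite T \<and> 0 \<in> T \<and> 1 \<in> T \<and> T \<subseteq> {0..1}"

text \<open>Two uses: with \<open>p < q\<close> it embeds a cell of a refinement into a cell of the coarser grid, and with
  \<open>p = q\<close> it finds the cell around a point that is not a node.\<close>

lemma grid_cell_enclosing:
  assumes "grid T" "0 \<le> p" "p \<le> q" "q \<le> 1" "T \<inter> {p<..<q} = {}" "p < q \<or> p \<notin> T"
  obtains P Q where "P \<in> T" "Q \<in> T" "P < Q" "P \<le> p" "q \<le> Q" "T \<inter> {P<..<Q} = {}"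
proof -
  let ?L = "{r\<in>T. r \<le> p}" and ?R = "{r\<in>T. q \<le> r}"
  have fin: "finite ?L" "finite ?R" and ne: "?L \<noteq> {}" "?R \<noteq> {}"
    using assms by (auto simp: grid_def)
  have L: "Max ?L \<in> ?L" and R: "Min ?R \<in> ?R"
    using Max_in[OF fin(1) ne(1)] Min_in[OF fin(2) ne(2)] by auto
  have "r \<notin> {Max ?L<..<Min ?R}" if "r \<in> T" for r
  proof -
    have "r \<le> p \<or> q \<le> r" using that assms(5) by force
    then have "r \<le> Max ?L \<or> Min ?R \<le> r"
      using Max_ge[OF fin(1), of r] Min_le[OF fin(2), of r] that by auto
    then show ?thesis by auto
  qed
  moreover have "Max ?L < Min ?R"
    using L R assms(3,6) by (smt (verit) mem_Collect_eq)
  ultimately show thesis using that[of "Max ?L" "Min ?R"] L R by blast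
qed

lemma fe_spaceD:
  assumes "u \<in> fe_space T"
  shows "continuous_on {0..1} u" "u 0 = 0" "u 1 = 0"
  using assms by (auto simp: fe_space_def)

lemma fe_space_affine:
  assumes "u \<in> fe_space T" "p \<in> T" "q \<in> T" "p < q" "T \<inter> {p<..<q} = {}"
  shows "\<exists>k d. \<forall>x\<in>{p..q}. u x = k * x + d"
  using assms unfolding fe_space_def by blast

lemma fe_space_refine:
  assumes "grid T" "grid T'" "T \<subseteq> T'" "u \<in> fe_space T"
  shows "u \<in> fe_space T'"
proof -
  have "\<exists>k d. \<forall>x\<in>{p..q}. u x = k * x + d"
    if pq: "p \<in> T'" "q \<in> T'" "p < q" "T' \<inter> {p<..<q} = {}" for p q
  proof -
    have "0 \<le> p" "q \<le> 1" "T \<inter> {p<..<q} = {}" using pq assms by (auto simp: grid_def)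
    then obtain P Q where PQ: "P \<in> T" "Q \<in> T" "P < Q" "P \<le> p" "q \<le> Q" "T \<inter> {P<..<Q} = {}"
      using grid_cell_enclosing[OF assms(1), of p q] pq(3) by auto
    from fe_space_affine[OF assms(4) PQ(1,2,3,6)] obtain k d
      where "\<And>x. x \<in> {P..Q} \<Longrightarrow> u x = k * x + d" by blast
    then show ?thesis using PQ by (intro exI[of _ k] exI[of _ d]) auto
  qed
  then show ?thesis using fe_spaceD[OF assms(4)] by (simp add: fe_space_def)
qed

lemma fe_space_lincomb:
  assumes "u \<in> fe_space T" "v \<in> fe_space T"
  shows "(\<lambda>x. \<alpha> * u x + \<beta> * v x) \<in> fe_space T"
proof -
  have "\<exists>k d. \<forall>x\<in>{p..q}. \<alpha> * u x + \<beta> * v x = k * x + d"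
    if pq: "p \<in> T" "q \<in> T" "p < q" "T \<inter> {p<..<q} = {}" for p q
  proof -
    from fe_space_affine[OF assms(1) pq] obtain k d
      where u: "\<And>x. x \<in> {p..q} \<Longrightarrow> u x = k * x + d" by blast
    from fe_space_affine[OF assms(2) pq] obtain k' d'
      where v: "\<And>x. x \<in> {p..q} \<Longrightarrow> v x = k' * x + d'" by blast
    have "\<alpha> * u x + \<beta> * v x = (\<alpha> * k + \<beta> * k') * x + (\<alpha> * d + \<beta> * d')" if "x \<in> {p..q}" for x
      using u[OF that] v[OF that] by (simp add: algebra_simps)
    then show ?thesis by blast
  qed
  moreover have "continuous_on {0..1} (\<lambda>x. \<alpha> * u x + \<beta> * v x)"
    by (intro continuous_intros fe_spaceD(1)[OF assms(1)] fe_spaceD(1)[OF assms(2)])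
  ultimately show ?thesis
    using fe_spaceD[OF assms(1)] fe_spaceD[OF assms(2)] by (simp add: fe_space_def)
qed

text \<open>Off the nodes the derivative is a difference quotient between two nodes. Hence it takes only
  finitely many values, which later yields boundedness.\<close>

lemma fe_space_has_derivative:
  assumes T: "grid T" and u: "u \<in> fe_space T" and x: "x \<in> {0..1} - T"
  shows fe_space_DERIV: "(u has_real_derivative deriv u x) (at x)"
    and fe_space_deriv_slope: "\<exists>p\<in>T. \<exists>q\<in>T. deriv u x = (u q - u p) / (q - p)"
proof -
  obtain p q where pq: "p \<in> T" "q \<in> T" "p < q" "p \<le> x" "x \<le> q" "T \<inter> {p<..<q} = {}"
    using grid_cell_enclosing[OF T, of x x] x by auto
  from fe_space_affine[OF u pq(1,2,3,6)] obtain k d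
    where kd: "\<And>x. x \<in> {p..q} \<Longrightarrow> u x = k * x + d" by blast
  have "x \<in> {p<..<q}" using pq x by (auto simp: less_le)
  moreover have "((\<lambda>x. k * x + d) has_real_derivative k) (at x)"
    by (auto intro!: derivative_eq_intros)
  ultimately have D: "(u has_real_derivative k) (at x)"
    by (intro has_field_derivative_transform_within_open
          [of "\<lambda>x. k * x + d" k x "{p<..<q}" u]) (auto simp: kd)
  then show "(u has_real_derivative deriv u x) (at x)" by (simp add: DERIV_imp_deriv)
  have "deriv u x = (u q - u p) / (q - p)"
    using DERIV_imp_deriv[OF D] kd[of p] kd[of q] pq(3) by (simp add: field_simps)
  then show "\<exists>p\<in>T. \<exists>q\<in>T. deriv u x = (u q - u p) / (q - p)" using pq by blast
qed

lemma fe_space_FTC: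
  assumes T: "grid T" and u: "u \<in> fe_space T" and y: "0 \<le> y" "y \<le> 1"
  shows "(deriv u has_integral u y) {0..y}"
proof -
  have "(deriv u has_integral (u y - u 0)) {0..y}"
  proof (rule fundamental_theorem_of_calculus_interior_strong[where S = T])
    show "(u has_vector_derivative deriv u x) (at x)" if "x \<in> {0<..<y} - T" for x
      using fe_space_DERIV[OF T u, of x] that y
      by (auto simp: has_real_derivative_iff_has_vector_derivative)
    show "continuous_on {0..y} u"
      using fe_spaceD(1)[OF u] by (rule continuous_on_subset) (use y in auto)
  qed (use T y in \<open>auto simp: grid_def\<close>)
  then show ?thesis using fe_spaceD(2)[OF u] by simp
qed

section \<open>Inner products of bounded functions\<close>

text \<open>A class containing the piecewise affine functions and their derivatives in which all products
  are integrable, so that \<open>L2_inner\<close> is additive and agrees with the gauge integral.\<close>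

definition bounded_measurable :: "(real \<Rightarrow> real) \<Rightarrow> bool" where
  "bounded_measurable g \<longleftrightarrow> g \<in> borel_measurable (lebesgue_on {0..1}) \<and> bounded (g ` {0..1})"

lemma bounded_measurable_integrable_mult:
  assumes "bounded_measurable g" "bounded_measurable h"
  shows "integrable (lebesgue_on {0..1}) (\<lambda>x. g x * h x)"
proof -
  obtain A B where A: "\<And>x. x \<in> {0..1} \<Longrightarrow> norm (g x) \<le> A"
    and B: "\<And>x. x \<in> {0..1} \<Longrightarrow> norm (h x) \<le> B"
    using assms unfolding bounded_measurable_def bounded_iff by (metis image_eqI)
  have gh: "g \<in> borel_measurable (lebesgue_on {0..1})"
      "h \<in> borel_measurable (lebesgue_on {0..1})"
    using assms by (auto simp: bounded_measurable_def)
  have "norm (g x * h x) \<le> A * B" if "x \<in> {0..1}" for x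
    unfolding norm_mult using A[OF that] B[OF that]
    by (intro mult_mono) (auto intro: order_trans[OF norm_ge_zero])
  then show ?thesis
    by (intro finite_measure.integrable_const_bound[where B = "A * B"] finite_measure_lebesgue_on
        borel_measurable_times AE_I2 gh) auto
qed

lemma bounded_measurable_continuous:
  assumes "continuous_on {0..1} u"
  shows "bounded_measurable u"
  unfolding bounded_measurable_def
  using continuous_imp_measurable_on_sets_lebesgue[OF assms]
    compact_imp_bounded[OF compact_continuous_image[OF assms]] by auto

lemma bounded_measurable_const [simp]: "bounded_measurable (\<lambda>_. k)"
  by (rule bounded_measurable_continuous) (rule continuous_on_const)

text \<open>Measurability comes from the fundamental theorem of calculus, as gauge integrable functions are
  measurable. The unknown values of \<^const>\<open>deriv\<close> at the nodes add only finitely many values.\<close>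

lemma bounded_measurable_deriv:
  assumes T: "grid T" and u: "u \<in> fe_space T"
  shows "bounded_measurable (deriv u)"
proof -
  have "deriv u integrable_on {0..1}"
    using fe_space_FTC[OF T u, of 1] by (auto simp: integrable_on_def)
  moreover have "deriv u ` {0..1} \<subseteq>
      (\<lambda>(p, q). (u q - u p) / (q - p)) ` (T \<times> T) \<union> deriv u ` T"
    using fe_space_deriv_slope[OF T u] by fastforce
  then have "finite (deriv u ` {0..1})"
    by (rule finite_subset) (use T in \<open>auto simp: grid_def\<close>)
  ultimately show ?thesis
    by (auto simp: bounded_measurable_def intro: integrable_imp_measurable finite_imp_bounded)
qed

lemma L2_inner_eq_integral:
  assumes "bounded_measurable u" "bounded_measurable v"
  shows "L2_inner u v = integral {0..1} (\<lambda>x. u x * v x)"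
  unfolding L2_inner_def
  by (intro lebesgue_integral_eq_integral bounded_measurable_integrable_mult assms) auto

lemma bounded_measurable_integrable_on:
  assumes "bounded_measurable u" "bounded_measurable v"
  shows "(\<lambda>x. u x * v x) integrable_on {0..1}"
  using integrable_on_lebesgue_on[OF bounded_measurable_integrable_mult[OF assms]] by auto

lemma L2_inner_cong_off_finite:
  assumes "bounded_measurable u" "bounded_measurable v" "bounded_measurable u'" "bounded_measurable v'"
    and "finite S" "\<And>x. x \<in> {0..1} - S \<Longrightarrow> u x * v x = u' x * v' x"
  shows "L2_inner u v = L2_inner u' v'"
  unfolding L2_inner_eq_integral[OF assms(1,2)] L2_inner_eq_integral[OF assms(3,4)]
  by (rule integral_spike[OF negligible_finite[OF assms(5)]]) (use assms(6) in auto)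

lemma L2_inner_lincomb_left:
  assumes "bounded_measurable u" "bounded_measurable v" "bounded_measurable w"
  shows "L2_inner (\<lambda>x. \<alpha> * u x + \<beta> * v x) w = \<alpha> * L2_inner u w + \<beta> * L2_inner v w"
proof -
  have "(\<lambda>x. (\<alpha> * u x + \<beta> * v x) * w x) = (\<lambda>x. \<alpha> * (u x * w x) + \<beta> * (v x * w x))"
    by (simp add: algebra_simps)
  then show ?thesis
    using bounded_measurable_integrable_mult[OF assms(1,3)]
      bounded_measurable_integrable_mult[OF assms(2,3)]
    by (simp add: L2_inner_def)
qed

section \<open>The bilinear form on piecewise affine functions\<close>

lemma bounded_measurable_lincomb:
  assumes "bounded_measurable u" "bounded_measurable v"
  shows "bounded_measurable (\<lambda>x. \<alpha> * u x + \<beta> * v x)"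
proof -
  have "bounded ((\<lambda>x. \<alpha> *\<^sub>R u x + \<beta> *\<^sub>R v x) ` {0..1})"
    using assms unfolding bounded_measurable_def
    by (intro bounded_plus_comp bounded_scaleR_comp) auto
  moreover have "(\<lambda>x. \<alpha> * u x + \<beta> * v x) \<in> borel_measurable (lebesgue_on {0..1})"
    using assms unfolding bounded_measurable_def
    by (intro borel_measurable_add borel_measurable_times borel_measurable_const) auto
  ultimately show ?thesis by (simp add: bounded_measurable_def)
qed

lemma fe_space_bounded_measurable:
  assumes "grid T" "u \<in> fe_space T"
  shows "bounded_measurable u" "bounded_measurable (deriv u)"
  using bounded_measurable_continuous[OF fe_spaceD(1)[OF assms(2)]]
    bounded_measurable_deriv[OF assms] by auto

lemma bilin_lincomb_left:
  assumes T: "grid T" and u: "u \<in> fe_space T" and v: "v \<in> fe_space T" and w: "w \<in> fe_space T"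
  shows "bilin \<epsilon> b c (\<lambda>x. \<alpha> * u x + \<beta> * v x) w = \<alpha> * bilin \<epsilon> b c u w + \<beta> * bilin \<epsilon> b c v w"
proof -
  note bm = fe_space_bounded_measurable[OF T u] fe_space_bounded_measurable[OF T v]
    fe_space_bounded_measurable[OF T w]
  let ?d = "\<lambda>x. \<alpha> * deriv u x + \<beta> * deriv v x"
  have "L2_inner (deriv (\<lambda>x. \<alpha> * u x + \<beta> * v x)) (deriv w) = L2_inner ?d (deriv w)"
  proof (rule L2_inner_cong_off_finite[where S = T])
    show "bounded_measurable (deriv (\<lambda>x. \<alpha> * u x + \<beta> * v x))"
      by (rule bounded_measurable_deriv[OF T fe_space_lincomb[OF u v]])
    show "finite T" using T by (simp add: grid_def)
    fix x assume x: "x \<in> {0..1} - T"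
    have "deriv (\<lambda>x. \<alpha> * u x + \<beta> * v x) x = ?d x"
      by (rule DERIV_imp_deriv)
         (intro DERIV_add DERIV_cmult fe_space_DERIV[OF T u x] fe_space_DERIV[OF T v x])
    then show "deriv (\<lambda>x. \<alpha> * u x + \<beta> * v x) x * deriv w x = ?d x * deriv w x" by simp
  qed (intro bm bounded_measurable_lincomb)+
  then show ?thesis
    by (simp add: bilin_def L2_inner_lincomb_left bm algebra_simps)
qed

text \<open>The product is the derivative of \<open>u\<^sup>2 / 2\<close>, which vanishes at both ends.\<close>

lemma L2_inner_deriv_self:
  assumes T: "grid T" and u: "u \<in> fe_space T"
  shows "L2_inner u (deriv u) = 0"
proof -
  have "((\<lambda>x. u x * deriv u x) has_integral ((u 1)\<^sup>2 / 2 - (u 0)\<^sup>2 / 2)) {0..1}"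
  proof (rule fundamental_theorem_of_calculus_interior_strong[where S = T])
    show "((\<lambda>x. (u x)\<^sup>2 / 2) has_vector_derivative u x * deriv u x) (at x)"
      if "x \<in> {0<..<1} - T" for x
      using that unfolding has_real_derivative_iff_has_vector_derivative[symmetric]
      by (auto intro!: derivative_eq_intros fe_space_DERIV[OF T u])
    show "continuous_on {0..1} (\<lambda>x. (u x)\<^sup>2 / 2)"
      by (intro continuous_intros fe_spaceD(1)[OF u]) simp
  qed (use T in \<open>auto simp: grid_def\<close>)
  then show ?thesis
    using L2_inner_eq_integral[OF fe_space_bounded_measurable[OF T u]] fe_spaceD[OF u]
    by (simp add: integral_unique)
qed

text \<open>The convection term drops out, so both remaining nonnegative terms vanish. Then \<open>u' = 0\<close> almost
  everywhere, and \<open>u\<close>, as the integral of its derivative from \<open>0\<close>, is zero.\<close>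

lemma bilin_self_eq_0_imp:
  assumes T: "grid T" and u: "u \<in> fe_space T" and \<epsilon>: "0 < \<epsilon>" and c: "0 \<le> c"
    and 0: "bilin \<epsilon> b c u u = 0" and y: "y \<in> {0..1}"
  shows "u y = 0"
proof -
  note bm = fe_space_bounded_measurable[OF T u]
  have "0 \<le> L2_inner (deriv u) (deriv u)" "0 \<le> c * L2_inner u u"
    using c by (auto simp: L2_inner_def)
  moreover have "\<epsilon> * L2_inner (deriv u) (deriv u) + c * L2_inner u u = 0"
    using 0 L2_inner_deriv_self[OF T u] by (simp add: bilin_def)
  ultimately have "L2_inner (deriv u) (deriv u) = 0"
    using \<epsilon> by (smt (verit) mult_pos_pos)
  then have "AE x in lebesgue_on {0..1}. deriv u x * deriv u x = 0"
    using integral_nonneg_eq_0_iff_AE[OF bounded_measurable_integrable_mult[OF bm(2) bm(2)]]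
    by (simp add: L2_inner_def)
  then have "AE x in lebesgue. x \<in> {0..1} \<longrightarrow> deriv u x = 0"
    by (simp add: AE_restrict_space_iff)
  then have "(deriv u has_integral u y) {0..y} \<longleftrightarrow> ((\<lambda>_. 0) has_integral u y) {0..y}"
    using y by (intro has_integral_AE) (auto simp: AE_completion_iff elim: eventually_mono)
  then show ?thesis
    using fe_space_FTC[OF T u] y by (simp add: has_integral_0_eq)
qed

section \<open>Functions orthogonal to the coarse space\<close>

text \<open>Truncating \<open>w\<close> at \<open>m\<close> gives an admissible test function \<open>z\<close> because \<open>w\<close> has no nodes
  in \<open>[0, m]\<close> beyond those of \<open>T\<close> and \<open>w m = 0\<close> keeps \<open>z\<close> continuous. Beyond \<open>m\<close> both \<open>z\<close> and \<open>z'\<close>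
  vanish, so testing \<open>w\<close> with \<open>z\<close> is the same as testing \<open>z\<close> with itself.\<close>

lemma orthogonal_vanishes_left:
  assumes T: "grid T" and T': "grid T'" and TT': "T \<subseteq> T'" and m: "m \<in> T"
    and same: "T' \<inter> {..m} = T \<inter> {..m}"
    and \<epsilon>: "0 < \<epsilon>" and c: "0 \<le> c" and w: "w \<in> fe_space T'" and wm: "w m = 0"
    and orth: "\<And>v. v \<in> fe_space T \<Longrightarrow> bilin \<epsilon> b c w v = 0"
    and y: "y \<in> {0..m}"
  shows "w y = 0"
proof -
  define z where "z x = (if x \<le> m then w x else 0)" for x
  have m01: "0 \<le> m" "m \<le> 1" using m T by (auto simp: grid_def)
  have fin: "finite T'" using T' by (simp add: grid_def)
  have "\<exists>k d. \<forall>x\<in>{p..q}. z x = k * x + d"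
    if pq: "p \<in> T" "q \<in> T" "p < q" "T \<inter> {p<..<q} = {}" for p q
  proof (cases "q \<le> m")
    case True
    have "T' \<inter> {p<..<q} = {}" using pq(4) same True by force
    from fe_space_affine[OF w _ _ pq(3) this] pq TT' obtain k d
      where "\<And>x. x \<in> {p..q} \<Longrightarrow> w x = k * x + d" by blast
    then show ?thesis using True by (intro exI[of _ k] exI[of _ d]) (auto simp: z_def)
  next
    case False
    then have "m \<le> p" using pq m by force
    then have "\<forall>x\<in>{p..q}. z x = 0 * x + 0" using wm by (auto simp: z_def dest: order_antisym)
    then show ?thesis by blast
  qed
  moreover have "continuous_on {0..1} z"
  proof -
    have "continuous_on {0..m} w"
      using fe_spaceD(1)[OF w] by (rule continuous_on_subset) (use m01 in auto)
    then have "continuous_on ({0..m} \<union> {m..1}) (\<lambda>x. if x \<le> m then w x else 0)"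
      by (intro continuous_on_cases) (auto simp: wm)
    moreover have "{0..m} \<union> {m..1} = {0..1}" using m01 by auto
    ultimately show ?thesis by (simp add: z_def[abs_def])
  qed
  ultimately have z: "z \<in> fe_space T"
    using fe_spaceD[OF w] m01 by (auto simp: fe_space_def z_def)
  note bm = fe_space_bounded_measurable[OF T z] fe_space_bounded_measurable[OF T' w]
  have dl: "deriv z x = deriv w x" if "x < m" for x
    by (rule deriv_cong_ev) (auto simp: z_def eventually_nhds intro!: exI[of _ "{..<m}"] that)
  have dr: "deriv z x = 0" if "m < x" for x
  proof -
    have "deriv z x = deriv (\<lambda>_. 0) x"
      by (rule deriv_cong_ev) (auto simp: z_def eventually_nhds intro!: exI[of _ "{m<..}"] that)
    then show ?thesis by simp
  qed
  have off: "deriv w x * deriv z x = deriv z x * deriv z x \<and> w x * deriv z x = z x * deriv z x \<and>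
      w x * z x = z x * z x" if "x \<in> {0..1} - {m}" for x
    using that dl[of x] dr[of x] by (cases "x < m") (auto simp: z_def)
  have "L2_inner (deriv w) (deriv z) = L2_inner (deriv z) (deriv z)"
    by (rule L2_inner_cong_off_finite[where S = "{m}"]) (use bm off in auto)
  moreover have "L2_inner w (deriv z) = L2_inner z (deriv z)"
    by (rule L2_inner_cong_off_finite[where S = "{m}"]) (use bm off in auto)
  moreover have "L2_inner w z = L2_inner z z"
    by (rule L2_inner_cong_off_finite[where S = "{m}"]) (use bm off in auto)
  ultimately have "bilin \<epsilon> b c z z = bilin \<epsilon> b c w z" by (simp add: bilin_def)
  then have "z y = 0"
    using bilin_self_eq_0_imp[OF T z \<epsilon> c] orth[OF z] y m01 by auto
  then show ?thesis using y by (simp add: z_def)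
qed

text \<open>Here \<open>w\<close> is \<open>\<beta>\<close> times the hat function at \<open>s\<close> with support \<open>[m, 1]\<close>, where \<open>\<beta> = w s\<close>. Against
  \<open>\<phi>\<close>, whose slope is constant on that support, the diffusion term is a multiple of the integral of
  \<open>w'\<close>, hence zero, and the other two terms combine to an integral of \<open>w\<close> against a weight positive on \<open>(m, 1)\<close>.
  It is here that \<open>b\<close> and \<open>c\<close> must not both vanish.\<close>

lemma orthogonal_vanishes_right:
  assumes T: "grid T" and m: "m \<in> T" "0 < m" "m < s" "s < 1" and above: "T \<inter> {m<..} = {1}"
    and b: "b \<le> 0" and c: "0 \<le> c" and bc: "\<not> (b = 0 \<and> c = 0)"
    and w: "w \<in> fe_space (T \<union> {s})" and w0: "\<And>y. y \<in> {0..m} \<Longrightarrow> w y = 0"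
    and orth: "\<And>v. v \<in> fe_space T \<Longrightarrow> bilin \<epsilon> b c w v = 0"
    and y: "y \<in> {0..1}"
  shows "w y = 0"
proof -
  have Ts: "grid (T \<union> {s})" using T m by (auto simp: grid_def)
  have beyond: "r = 1" if "r \<in> T" "m < r" for r
    using above that by blast
  have gaps: "(T \<union> {s}) \<inter> {m<..<s} = {}" "(T \<union> {s}) \<inter> {s<..<1} = {}"
    using beyond m by fastforce+
  have one: "1 \<in> T" using T by (simp add: grid_def)
  have wm: "w m = 0" using w0 m by auto
  define \<beta> where "\<beta> = w s"
  define hat where "hat x = (if x \<le> m then 0 else if x \<le> s then (x - m) / (s - m) else (1 - x) / (1 - s))" for x
  have wl: "w x = \<beta> * ((x - m) / (s - m))" if "x \<in> {m..s}" for x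
  proof -
    obtain k d where kd: "\<And>x. x \<in> {m..s} \<Longrightarrow> w x = k * x + d"
      using fe_space_affine[OF w _ _ m(3) gaps(1)] m(1) by blast
    have "k * m + d = 0" "\<beta> = k * s + d" using kd[of m] kd[of s] m wm by (auto simp: \<beta>_def)
    then have "w x = k * (x - m)" "\<beta> = k * (s - m)" using kd[OF that] by (simp_all add: algebra_simps)
    then show ?thesis using m by simp
  qed
  have wr: "w x = \<beta> * ((1 - x) / (1 - s))" if "x \<in> {s..1}" for x
  proof -
    obtain k d where kd: "\<And>x. x \<in> {s..1} \<Longrightarrow> w x = k * x + d"
      using fe_space_affine[OF w _ _ m(4) gaps(2)] one by blast
    have "k + d = 0" "\<beta> = k * s + d"
      using kd[of 1] kd[of s] m fe_spaceD(3)[OF w] by (auto simp: \<beta>_def)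
    then have "w x = - k * (1 - x)" "\<beta> = - k * (1 - s)"
      using kd[OF that] by (simp_all add: algebra_simps)
    then show ?thesis using m by simp
  qed
  have w_hat: "w x = \<beta> * hat x" if "x \<in> {0..1}" for x
    using that wl[of x] wr[of x] w0[of x] by (auto simp: hat_def)
  have hat_nonneg: "0 \<le> hat x" if "x \<in> {0..1}" for x
    using that m by (auto simp: hat_def)

  define \<phi> where "\<phi> x = (if x \<le> m then x / m else (1 - x) / (1 - m))" for x
  have \<phi>: "\<phi> \<in> fe_space T"
  proof -
    have "\<exists>k d. \<forall>x\<in>{p..q}. \<phi> x = k * x + d"
      if pq: "p \<in> T" "q \<in> T" "p < q" "T \<inter> {p<..<q} = {}" for p q
    proof (cases "q \<le> m")
      case True
      then have "\<forall>x\<in>{p..q}. \<phi> x = (1 / m) * x + 0" by (auto simp: \<phi>_def)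
      then show ?thesis by blast
    next
      case False
      then have "m \<le> p" using pq m(1) by force
      then have "\<forall>x\<in>{p..q}. \<phi> x = (- 1 / (1 - m)) * x + 1 / (1 - m)"
        using m by (auto simp: \<phi>_def field_simps)
      then show ?thesis by blast
    qed
    moreover have "continuous_on {0..1} \<phi>"
    proof -
      have "continuous_on ({0..m} \<union> {m..1}) (\<lambda>x. if x \<le> m then x / m else (1 - x) / (1 - m))"
        by (intro continuous_on_cases continuous_intros) (use m in auto)
      moreover have "{0..m} \<union> {m..1} = {0..1}" using m by auto
      ultimately show ?thesis by (simp add: \<phi>_def[abs_def])
    qed
    ultimately show ?thesis using m by (auto simp: fe_space_def \<phi>_def)
  qed
  have \<phi>_nonneg: "0 \<le> \<phi> x" if "x \<in> {0..1}" for x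
    using that m by (auto simp: \<phi>_def)
  note bm = fe_space_bounded_measurable[OF T \<phi>] fe_space_bounded_measurable[OF Ts w]

  have d\<phi>: "deriv \<phi> x = - 1 / (1 - m)" if "m < x" for x
  proof -
    have "deriv \<phi> x = deriv (\<lambda>x. (1 - x) / (1 - m)) x"
      by (rule deriv_cong_ev) (auto simp: \<phi>_def eventually_nhds intro!: exI[of _ "{m<..}"] that)
    also have "\<dots> = - 1 / (1 - m)"
    proof (rule DERIV_imp_deriv, rule DERIV_cdivide)
      show "((\<lambda>x. 1 - x) has_real_derivative - 1) (at x)"
        by (auto intro!: derivative_eq_intros)
    qed
    finally show ?thesis .
  qed
  have dw: "deriv w x = 0" if "x \<in> {0<..<m}" for x
  proof -
    have "deriv w x = deriv (\<lambda>_. 0) x"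
      by (rule deriv_cong_ev)
         (use that w0 in \<open>auto simp: eventually_nhds intro!: exI[of _ "{0<..<m}"]\<close>)
    then show ?thesis by simp
  qed
  have "L2_inner (deriv w) (deriv \<phi>) = L2_inner (deriv w) (\<lambda>_. - 1 / (1 - m))"
  proof (rule L2_inner_cong_off_finite[where S = "{0, m}"])
    show "deriv w x * deriv \<phi> x = deriv w x * (- 1 / (1 - m))" if "x \<in> {0..1} - {0, m}" for x
      using that dw[of x] d\<phi>[of x] by (cases "x < m") auto
  qed (use bm in auto)
  also have "\<dots> = 0"
    using fe_space_FTC[OF Ts w, of 1] fe_spaceD(3)[OF w] m
    by (subst L2_inner_eq_integral) (auto simp: bm integral_unique)
  finally have I1: "L2_inner (deriv w) (deriv \<phi>) = 0" .
  have "L2_inner w (deriv \<phi>) = L2_inner w (\<lambda>_. - 1 / (1 - m))"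
  proof (rule L2_inner_cong_off_finite[where S = "{m}"])
    show "w x * deriv \<phi> x = w x * (- 1 / (1 - m))" if "x \<in> {0..1} - {m}" for x
      using that w0[of x] d\<phi>[of x] by (cases "x < m") auto
  qed (use bm in auto)
  then have I2: "L2_inner w (deriv \<phi>) = integral {0..1} (\<lambda>x. w x * (- 1 / (1 - m)))"
    using L2_inner_eq_integral[OF bm(3) bounded_measurable_const] by simp
  define g where "g x = - b / (1 - m) + c * \<phi> x" for x
  have g_nonneg: "0 \<le> g x" if "x \<in> {0..1}" for x
    unfolding g_def using \<phi>_nonneg[OF that] b c m
    by (intro add_nonneg_nonneg divide_nonneg_nonneg mult_nonneg_nonneg) auto
  have "0 = bilin \<epsilon> b c w \<phi>" using orth[OF \<phi>] by simp
  also have "\<dots> = b * integral {0..1} (\<lambda>x. w x * (- 1 / (1 - m))) + c * integral {0..1} (\<lambda>x. w x * \<phi> x)"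
    unfolding bilin_def I1 I2 L2_inner_eq_integral[OF bm(3) bm(1)] by simp
  also have "\<dots> = integral {0..1} (\<lambda>x. b * (w x * (- 1 / (1 - m))) + c * (w x * \<phi> x))"
    by (subst integral_add)
       (intro integrable_on_mult_right bounded_measurable_integrable_on bm bounded_measurable_const | simp)+
  also have "\<dots> = integral {0..1} (\<lambda>x. w x * g x)"
    by (rule integral_cong) (simp add: g_def algebra_simps)
  \<comment> \<open>The extra factor \<open>\<beta>\<close> turns the integrand \<open>w g\<close>, whose sign is that of \<open>\<beta>\<close>, into a nonnegative
    continuous function.\<close>
  finally have "integral {0..1} (\<lambda>x. \<beta> * (w x * g x)) = 0" by simp
  moreover have "continuous_on {0..1} (\<lambda>x. \<beta> * (w x * g x))"
    unfolding g_def by (intro continuous_intros fe_spaceD(1)[OF w] fe_spaceD(1)[OF \<phi>])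
  moreover have "0 \<le> \<beta> * (w x * g x)" if "x \<in> {0..1}" for x
  proof -
    have "\<beta> * (w x * g x) = \<beta>\<^sup>2 * (hat x * g x)"
      by (simp add: w_hat[OF that] power2_eq_square)
    also have "\<dots> \<ge> 0" using hat_nonneg[OF that] g_nonneg[OF that] by simp
    finally show ?thesis .
  qed
  ultimately have "\<forall>x\<in>{0..1}. \<beta> * (w x * g x) = 0"
    by (subst (asm) integral_eq_0_iff) auto
  then have "\<beta> * (w s * g s) = 0" using m by auto
  moreover have "0 < g s"
  proof -
    have "0 < \<phi> s" using m by (simp add: \<phi>_def)
    moreover have "0 < - b / (1 - m) \<or> 0 < c" "0 \<le> - b / (1 - m)"
      using b c bc m by (auto simp: less_le divide_nonpos_pos)
    ultimately show ?thesis using c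
      by (metis g_def add_nonneg_pos add_pos_nonneg mult_nonneg_nonneg mult_pos_pos less_imp_le)
  qed
  ultimately have "\<beta> = 0" by (auto simp: \<beta>_def)
  then show ?thesis using w_hat[OF y] by simp
qed

section \<open>Intersection points\<close>

lemma intersection_point_cong:
  assumes "\<And>y. y \<in> A \<Longrightarrow> u y = v y \<longleftrightarrow> u y = v' y"
  shows "intersection_point u v A Q \<longleftrightarrow> intersection_point u v' A Q"
proof -
  have "graph_over A u \<inter> graph_over A v = graph_over A u \<inter> graph_over A v'"
    using assms by (auto simp: graph_over_def image_iff)
  then show ?thesis by (simp add: intersection_point_def)
qed

text \<open>Graphs that agree on an open interval share infinitely many points, not one.\<close>

lemma intersection_point_imp_differ:
  fixes p q :: real
  assumes "p < q" "intersection_point u v {p<..<q} Q"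
  shows "\<exists>y\<in>{p<..<q}. v y \<noteq> u y"
proof (rule ccontr)
  assume "\<not> ?thesis"
  then have "graph_over {p<..<q} u = graph_over {p<..<q} v"
    by (auto simp: graph_over_def image_iff)
  then have "graph_over {p<..<q} u = {Q}" using assms by (simp add: intersection_point_def)
  then have "finite {p<..<q}"
    unfolding graph_over_def by (metis finite.emptyI finite.insertI finite_imageD inj_on_convol_ident)
  then show False using infinite_Ioo[OF assms(1)] by contradiction
qed

section \<open>Independence of the added node\<close>

theorem theorem3p1:
  fixes \<epsilon> b c :: real and f :: "real \<Rightarrow> real"
    and n :: nat and x :: "nat \<Rightarrow> real" and T :: "real set" and u :: "real \<Rightarrow> real"
  assumes "0 < \<epsilon>" and "b \<le> 0" and "0 \<le> c" and "\<not> (b = 0 \<and> c = 0)"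
    and "f \<in> L2_space"
    and "2 \<le> n" and "x 0 = 0" and "x (n + 1) = 1" and "strict_mono_on {0..n + 1} x"
    and "T = x ` {0..n + 1}"
    and "fe_solution \<epsilon> b c f T u"
  shows "\<forall>s\<in>{x n<..<x (n + 1)}. \<forall>t\<in>{x n<..<x (n + 1)}. \<forall>us ut.
           fe_solution \<epsilon> b c f (T \<union> {s}) us \<and> fe_solution \<epsilon> b c f (T \<union> {t}) ut \<longrightarrow>
           (\<forall>i\<in>{2..n}. \<forall>Q.
              intersection_point u us {x (i - 1)<..<x i} Q \<longrightarrow>
              intersection_point u ut {x (i - 1)<..<x i} Q \<or> (\<forall>y\<in>{0..1}. ut y = u y))"
proof (intro ballI allI impI)
  fix s t us ut i Q
  assume s: "s \<in> {x n<..<x (n + 1)}" and t: "t \<in> {x n<..<x (n + 1)}"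
    and sol: "fe_solution \<epsilon> b c f (T \<union> {s}) us \<and> fe_solution \<epsilon> b c f (T \<union> {t}) ut"
    and i: "i \<in> {2..n}" and Q: "intersection_point u us {x (i - 1)<..<x i} Q"
  have less: "x j < x k" if "j < k" "k \<le> n + 1" for j k
    using that by (intro strict_mono_onD[OF assms(9)]) auto
  have le: "x j \<le> x k" if "j \<le> k" "k \<le> n + 1" for j k
    using less[of j k] that by (cases "j = k") auto
  define m where "m = x n"
  have m: "m \<in> T" "0 < m" "m < s" "s < 1" "m < t" "t < 1"
    using less[of 0 n] s t assms(6,7,8,10) by (auto simp: m_def)
  have T: "grid T"
    using le[of 0] le[of _ "n + 1"] assms(7,8)
    by (auto simp: grid_def assms(10) image_iff intro: bexI[of _ 0] bexI[of _ "n + 1"])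
  have above: "T \<inter> {m<..} = {1}"
  proof -
    have "x j = 1" if "j \<le> n + 1" "m < x j" for j
      using le[of j n] that assms(8) by (cases "j \<le> n") (auto simp: m_def le_Suc_eq)
    then show ?thesis using T m by (auto simp: assms(10) grid_def)
  qed
  define T' where "T' = T \<union> {s, t}"
  have T': "grid T'" and Ts: "grid (T \<union> {s})" and Tt: "grid (T \<union> {t})"
    using T m by (auto simp: grid_def T'_def)
  have same: "T' \<inter> {..m} = T \<inter> {..m}" using m by (auto simp: T'_def)
  have u: "u \<in> fe_space T" "\<And>v. v \<in> fe_space T \<Longrightarrow> bilin \<epsilon> b c u v = L2_inner f v"
    using assms(11) by (auto simp: fe_solution_def)

  have diff: "(\<lambda>y. 1 * ur y + (- 1) * u y) \<in> fe_space (T \<union> {r})"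
    "\<And>v. v \<in> fe_space T \<Longrightarrow> bilin \<epsilon> b c (\<lambda>y. 1 * ur y + (- 1) * u y) v = 0"
    if "fe_solution \<epsilon> b c f (T \<union> {r}) ur" "grid (T \<union> {r})" for r ur
  proof -
    have sub: "v \<in> fe_space (T \<union> {r})" if "v \<in> fe_space T" for v
      using fe_space_refine[OF T \<open>grid (T \<union> {r})\<close> _ that] by auto
    have ur: "ur \<in> fe_space (T \<union> {r})" using that by (simp add: fe_solution_def)
    show "(\<lambda>y. 1 * ur y + (- 1) * u y) \<in> fe_space (T \<union> {r})"
      by (rule fe_space_lincomb[OF ur sub[OF u(1)]])
    fix v assume v: "v \<in> fe_space T"
    have "bilin \<epsilon> b c ur v = L2_inner f v"
      using that(1) sub[OF v] by (simp add: fe_solution_def)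
    then show "bilin \<epsilon> b c (\<lambda>y. 1 * ur y + (- 1) * u y) v = 0"
      using bilin_lincomb_left[OF that(2) ur sub[OF u(1)] sub[OF v], of \<epsilon> b c 1 "- 1"] u(2)[OF v]
      by simp
  qed
  define ws where "ws = (\<lambda>y. 1 * us y + (- 1) * u y)"
  define wt where "wt = (\<lambda>y. 1 * ut y + (- 1) * u y)"
  have ws: "ws \<in> fe_space (T \<union> {s})" "\<And>v. v \<in> fe_space T \<Longrightarrow> bilin \<epsilon> b c ws v = 0"
    unfolding ws_def using diff sol Ts by blast+
  have wt: "wt \<in> fe_space (T \<union> {t})" "\<And>v. v \<in> fe_space T \<Longrightarrow> bilin \<epsilon> b c wt v = 0"
    unfolding wt_def using diff sol Tt by blast+
  have ws': "ws \<in> fe_space T'" by (rule fe_space_refine[OF Ts T' _ ws(1)]) (auto simp: T'_def)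
  have wt': "wt \<in> fe_space T'" by (rule fe_space_refine[OF Tt T' _ wt(1)]) (auto simp: T'_def)
  have sub': "v \<in> fe_space T'" if "v \<in> fe_space T" for v
    using fe_space_refine[OF T T' _ that] by (auto simp: T'_def)
  have vanish: "w y = 0"
    if "w \<in> fe_space T'" "w m = 0" "\<And>v. v \<in> fe_space T \<Longrightarrow> bilin \<epsilon> b c w v = 0" "y \<in> {0..m}" for w y
    by (rule orthogonal_vanishes_left[OF T T' _ m(1) same assms(1,3) that]) (auto simp: T'_def)

  have "0 \<le> x (i - 1)" "x i \<le> m" "x (i - 1) < x i"
    using le[of 0 "i - 1"] le[of i n] less[of "i - 1" i] i assms(7) by (auto simp: m_def)
  then have cell: "{x (i - 1)<..<x i} \<subseteq> {0..m}" by auto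
  obtain y0 where "y0 \<in> {x (i - 1)<..<x i}" "us y0 \<noteq> u y0"
    using intersection_point_imp_differ[OF \<open>x (i - 1) < x i\<close> Q] by blast
  then have wsm: "ws m \<noteq> 0"
    using vanish[OF ws' _ ws(2), of y0] cell by (auto simp: ws_def)
  have proportional: "ws m * wt y = wt m * ws y" if y: "y \<in> {0..m}" for y
  proof -
    let ?D = "\<lambda>y. ws m * wt y + (- wt m) * ws y"
    have "bilin \<epsilon> b c ?D v = 0" if "v \<in> fe_space T" for v
      using bilin_lincomb_left[OF T' wt' ws' sub'[OF that], of \<epsilon> b c "ws m" "- wt m"]
        ws(2)[OF that] wt(2)[OF that] by simp
    then have "?D y = 0"
      by (intro vanish[OF fe_space_lincomb[OF wt' ws'] _ _ y]) simp_all
    then show ?thesis by simp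
  qed
  show "intersection_point u ut {x (i - 1)<..<x i} Q \<or> (\<forall>y\<in>{0..1}. ut y = u y)"
  proof (cases "wt m = 0")
    case True
    have "wt y = 0" if "y \<in> {0..1}" for y
      using orthogonal_vanishes_right[OF T m(1,2,5,6) above assms(2,3,4) wt(1)
          vanish[OF wt' True wt(2)] wt(2) that]
      by blast
    then show ?thesis by (simp add: wt_def)
  next
    case False
    have "u y = us y \<longleftrightarrow> u y = ut y" if "y \<in> {x (i - 1)<..<x i}" for y
    proof -
      have "ws y = 0 \<longleftrightarrow> wt y = 0" using proportional[of y] that cell wsm False by auto
      then have "us y = u y \<longleftrightarrow> ut y = u y" by (simp add: ws_def wt_def)
      then show ?thesis by metis
    qed
    then have "intersection_point u us {x (i - 1)<..<x i} Q \<longleftrightarrow>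
        intersection_point u ut {x (i - 1)<..<x i} Q"
      by (rule intersection_point_cong)
    then show ?thesis using Q by simp
  qed
qed

end
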